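(* Let $k_1,\dots,k_n$ be positive integers with $\gcd(k_1,\dots,k_n)=1$, and let \[ \Omega_B=\left\{(z_1,\dots,z_n)\in\mathbb{C}^n : |z_1|^{k_1}<|z_2|^{k_2}\cdots|z_n|^{k_n},\ |z_j|<1,\ j=2,\dots,n\right\}. \] Let $1\le p<\infty$. Then \[ S_p(\Omega_B)=\left\{(\alpha_1,\dots,\alpha_n)\in\mathbb{Z}^n : \alpha_1p>-2,\ (k_j\alpha_1+k_1\alpha_j)p>-2(k_1+k_j)\ \text{for all }2\le j\le n\right\}. \] The set of Threshold exponents of $\Omega_B$ is \[ \mathrm{Threshold}(\Omega_B)=\left\{\frac{R_{1,j}}{\ell_j} : 2\le j\le n,\ \ell_j\in\mathbb{Z},\ 1\le \ell_j\le R_{1,j}-1\right\}, \] where \[ R_{1,j}:=\frac{2(k_1+k_j)}{\gcd(k_1,k_j)}. \]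
   Context: For a domain $\Omega\subset\mathbb{C}^n$ and $1\le p<\infty$, the $p$-Bergman space $A^p(\Omega)$ is the space of holomorphic functions $f$ on $\Omega$ with $\int_\Omega |f|^p\,dV<\infty$, where $dV$ is Lebesgue measure. For $\alpha=(\alpha_1,\dots,\alpha_n)\in\mathbb{Z}^n$, $e_\alpha(z):=z_1^{\alpha_1}\cdots z_n^{\alpha_n}$, with the convention that negative exponents are interpreted as Laurent monomials whenever they are locally integrable. For a Reinhardt domain $\Omega$ (a domain invariant under $(z_1,\dots,z_n)\mapsto(e^{i\tau_1}z_1,\dots,e^{i\tau_n}z_n)$ for all real $\tau_1,\dots,\tau_n$), the $p$-allowable index set is $S_p(\Omega):=\{\alpha\in\mathbb{Z}^n : e_\alpha\in A^p(\Omega)\}$. A number $p\in[1,\infty)$ is called a Threshold exponent for $\Omega$ if for every $\varepsilon>0$ there exists $q\in(p-\varepsilon,p+\varepsilon)$ such that $S_q(\Omega)\neq S_p(\Omega)$. $\mathrm{Threshold}(\Omega)$ denotes the set of Threshold exponents of $\Omega$. *)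

theory Defs
  imports "HOL-Analysis.Analysis"
begin

text \<open>Points of $\mathbf{C}^n$ are elements of \<open>complex ^ 'n\<close> with \<open>n = CARD('n)\<close>; its
  \<open>lborel\<close> is Lebesgue measure on $\mathbf{R}^{2n}$.\<close>

text \<open>Holomorphy in several variables on an open set: the real Frechet derivative exists at every
  point and is complex linear.\<close>

definition holomorphic_sv_on :: "(complex ^ 'n \<Rightarrow> complex) \<Rightarrow> (complex ^ 'n) set \<Rightarrow> bool" where
  "holomorphic_sv_on f \<Omega> \<longleftrightarrow>
     (\<forall>z\<in>\<Omega>. \<exists>D. (f has_derivative D) (at z) \<and> (\<forall>c v. D (c *s v) = c * D v))"

definition bergman_space :: "real \<Rightarrow> (complex ^ 'n) set \<Rightarrow> (complex ^ 'n \<Rightarrow> complex) set" where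
  "bergman_space p \<Omega> =
     {f. holomorphic_sv_on f \<Omega> \<and> (\<integral>\<^sup>+z\<in>\<Omega>. ennreal (cmod (f z) powr p) \<partial>lborel) < \<infinity>}"

definition locally_integrable_on :: "(complex ^ 'n \<Rightarrow> complex) \<Rightarrow> (complex ^ 'n) set \<Rightarrow> bool" where
  "locally_integrable_on f \<Omega> \<longleftrightarrow> (\<forall>K. compact K \<and> K \<subseteq> \<Omega> \<longrightarrow> set_integrable lborel K f)"

definition laurent_monomial :: "int ^ 'n \<Rightarrow> complex ^ 'n \<Rightarrow> complex" where
  "laurent_monomial \<alpha> z = (\<Prod>i\<in>UNIV. (z $ i) powi (\<alpha> $ i))"

definition laurent_domain :: "int ^ 'n \<Rightarrow> (complex ^ 'n) set \<Rightarrow> (complex ^ 'n) set" where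
  "laurent_domain \<alpha> \<Omega> = {z \<in> \<Omega>. \<forall>i. \<alpha> $ i < 0 \<longrightarrow> z $ i \<noteq> 0}"

text \<open>A monomial with negative exponents counts as an element of the Bergman space of \<open>\<Omega>\<close> even if
  its polar set meets \<open>\<Omega>\<close>, provided that it is locally integrable on \<open>\<Omega>\<close>. The polar set is a null
  set, and it is removed because the monomial is holomorphic only off it. If it does not meet
  \<open>\<Omega>\<close>, then \<open>laurent_domain \<alpha> \<Omega> = \<Omega>\<close>.\<close>

definition allowable_indices :: "real \<Rightarrow> (complex ^ 'n) set \<Rightarrow> (int ^ 'n) set" where
  "allowable_indices p \<Omega> =
     {\<alpha>. locally_integrable_on (laurent_monomial \<alpha>) \<Omega> \<and>
         laurent_monomial \<alpha> \<in> bergman_space p (laurent_domain \<alpha> \<Omega>)}"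

text \<open>The nearby exponents \<open>q\<close> range over $[1,\infty)$, where the Bergman spaces are considered.\<close>

definition threshold_exponents :: "(complex ^ 'n) set \<Rightarrow> real set" where
  "threshold_exponents \<Omega> =
     {p. 1 \<le> p \<and>
         (\<forall>\<epsilon>>0. \<exists>q\<in>{p - \<epsilon><..<p + \<epsilon>}.
            1 \<le> q \<and> allowable_indices q \<Omega> \<noteq> allowable_indices p \<Omega>)}"

text \<open>The index \<open>a\<close> plays the role of the first coordinate.\<close>

definition Omega_B :: "('n \<Rightarrow> nat) \<Rightarrow> 'n \<Rightarrow> (complex ^ 'n) set" where
  "Omega_B k a =
     {z. cmod (z $ a) ^ k a < (\<Prod>j\<in>UNIV - {a}. cmod (z $ j) ^ k j) \<and>
         (\<forall>j. j \<noteq> a \<longrightarrow> cmod (z $ j) < 1)}"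

definition R_index :: "('n \<Rightarrow> nat) \<Rightarrow> 'n \<Rightarrow> 'n \<Rightarrow> real" where
  "R_index k a j = 2 * (real (k a) + real (k j)) / real (gcd (k a) (k j))"

end

theory Submission
  imports Defs
begin

text \<open>Up to a null set the modulus of a Laurent monomial is a product of real powers of the
  coordinate moduli. Integrating over the first coordinate gives a power of the slice radius, which
  is itself a monomial, so the integral over \<open>Omega_B\<close> factors into moments of the unit disc; the
  moment of exponent \<open>s\<close> is finite iff \<open>s > -2\<close>. Since compact sets have finite measure,
  $p$-integrability with $p \ge 1$ already implies local integrability. The thresholds are then the
  points at which some integer condition $m p < R$ changes its truth value.\<close>

section \<open>Lebesgue measure on vectors as a product measure\<close>

lemma measurable_vec_lambda_PiM [measurable]:
  "(\<lambda>f. \<chi> i. f i) \<in> borel_measurable (PiM UNIV (\<lambda>_::'n::finite. lborel :: 'a::euclidean_space measure))"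
proof (subst borel_measurable_euclidean_space, intro ballI)
  fix b :: "'a ^ 'n" assume "b \<in> Basis"
  then obtain i c where b: "b = axis i c" "c \<in> Basis"
    by (auto simp: Basis_vec_def)
  show "(\<lambda>f. (\<chi> i. f i) \<bullet> b) \<in> borel_measurable (PiM UNIV (\<lambda>_::'n::finite. lborel :: 'a::euclidean_space measure))"
    unfolding b inner_axis vec_lambda_beta by measurable
qed

text \<open>Lebesgue measure is determined by its values on boxes, and the preimage of a box is a
  product of boxes. This makes Fubini over the coordinates available.\<close>

lemma lborel_vec:
  "(lborel :: ('a::euclidean_space ^ 'n::finite) measure) =
     distr (PiM UNIV (\<lambda>_. lborel)) borel (\<lambda>f. \<chi> i. f i)"
proof -
  interpret product_sigma_finite "\<lambda>_::'n. lborel :: 'a measure" ..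
  let ?T = "(\<lambda>f. \<chi> i. f i) :: ('n \<Rightarrow> 'a) \<Rightarrow> 'a ^ 'n"
  show ?thesis
  proof (rule lborel_eqI)
    fix l u :: "'a ^ 'n" assume le: "\<And>b. b \<in> Basis \<Longrightarrow> l \<bullet> b \<le> u \<bullet> b"
    have le': "(l $ i) \<bullet> c \<le> (u $ i) \<bullet> c" if "c \<in> Basis" for i c
      using le[of "axis i c"] that by (simp add: inner_axis)
    have pre: "?T -` box l u \<inter> space (PiM UNIV (\<lambda>_. lborel)) = PiE UNIV (\<lambda>i. box (l $ i) (u $ i))"
      by (auto simp: space_PiM mem_box Basis_vec_def inner_axis PiE_def Pi_def)
    have "emeasure (distr (PiM UNIV (\<lambda>_. lborel)) borel ?T) (box l u)
        = (\<Prod>i\<in>UNIV. emeasure lborel (box (l $ i) (u $ i)))"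
      by (subst emeasure_distr) (auto simp: pre emeasure_PiM)
    also have "\<dots> = (\<Prod>i\<in>UNIV. ennreal (\<Prod>c\<in>Basis. (u $ i - l $ i) \<bullet> c))"
      using le' by (intro prod.cong refl emeasure_lborel_box) auto
    also have "\<dots> = ennreal (\<Prod>i\<in>UNIV. \<Prod>c\<in>Basis. (u $ i - l $ i) \<bullet> c)"
      using le' by (intro prod_ennreal prod_nonneg) (auto simp: inner_diff_left)
    also have "(\<Prod>i\<in>UNIV. \<Prod>c\<in>Basis. (u $ i - l $ i) \<bullet> c) = (\<Prod>b\<in>Basis. (u - l) \<bullet> b)"
    proof -
      \<comment> \<open>Basis vectors correspond to pairs of a coordinate and a basis vector of
        \<open>'a\<close>, so the product of the side lengths is a double product.\<close>
      have "bij_betw (\<lambda>(i, c). axis i c) (UNIV \<times> Basis) (Basis :: ('a ^ 'n) set)"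
        unfolding bij_betw_def
      proof
        show "inj_on (\<lambda>(i, c). axis i c :: 'a ^ 'n) (UNIV \<times> Basis)"
          by (auto simp: inj_on_def axis_eq_axis)
        show "(\<lambda>(i, c). axis i c) ` (UNIV \<times> Basis) = (Basis :: ('a ^ 'n) set)"
          unfolding Basis_vec_def by fast
      qed
      from prod.reindex_bij_betw[OF this, of "\<lambda>b. (u - l) \<bullet> b"]
      have "(\<Prod>b\<in>Basis. (u - l) \<bullet> b) = (\<Prod>(i, c)\<in>UNIV \<times> Basis. (u - l) \<bullet> axis i c)"
        by (simp add: case_prod_beta)
      then show ?thesis
        by (simp add: prod.cartesian_product inner_axis)
    qed
    finally show "emeasure (distr (PiM UNIV (\<lambda>_. lborel)) borel ?T) (box l u)
        = ennreal (\<Prod>b\<in>Basis. (u - l) \<bullet> b)" .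
  qed simp
qed

lemma nn_integral_lborel_vec:
  fixes f :: "'a::euclidean_space ^ 'n::finite \<Rightarrow> ennreal"
  assumes [measurable]: "f \<in> borel_measurable borel"
  shows "(\<integral>\<^sup>+z. f z \<partial>lborel) = (\<integral>\<^sup>+x. f (\<chi> i. x i) \<partial>PiM UNIV (\<lambda>_. lborel))"
  by (subst lborel_vec, subst nn_integral_distr) simp_all

section \<open>Radial power integrals over balls\<close>

lemma nn_integral_scaleR_lborel:
  fixes f :: "'a::euclidean_space \<Rightarrow> ennreal"
  assumes [measurable]: "f \<in> borel_measurable borel" and "c > 0"
  shows "(\<integral>\<^sup>+x. f x \<partial>lborel) = ennreal (c ^ DIM('a)) * (\<integral>\<^sup>+x. f (c *\<^sub>R x) \<partial>lborel)"
proof -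
  have "(\<integral>\<^sup>+x. f x \<partial>lborel)
      = (\<integral>\<^sup>+x. f x \<partial>density (distr lborel borel (\<lambda>x. 0 + c *\<^sub>R x)) (\<lambda>_. \<bar>c\<bar> ^ DIM('a)))"
    using assms by (subst lborel_affine[of c 0]) auto
  also have "\<dots> = ennreal (c ^ DIM('a)) * (\<integral>\<^sup>+x. f (c *\<^sub>R x) \<partial>lborel)"
    using assms by (simp add: nn_integral_density nn_integral_distr nn_integral_cmult)
  finally show ?thesis .
qed

text \<open>Homogeneity of the norm and the Jacobian \<open>c ^ DIM('a)\<close> combine into one
  power of \<open>c\<close>. The set \<open>S\<close> is arbitrary because both balls and annuli get
  rescaled.\<close>

lemma nn_integral_norm_powr_scale:
  fixes S :: "'a::euclidean_space set"
  assumes [measurable]: "S \<in> sets borel" and "c > 0"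
  shows "(\<integral>\<^sup>+x. ennreal (norm x powr s) * indicator S x \<partial>lborel) =
         ennreal (c powr (s + DIM('a))) *
           (\<integral>\<^sup>+x. ennreal (norm x powr s) * indicator S (c *\<^sub>R x) \<partial>lborel)"
proof -
  have "(\<integral>\<^sup>+x. ennreal (norm x powr s) * indicator S x \<partial>lborel) =
      ennreal (c ^ DIM('a)) *
        (\<integral>\<^sup>+x. ennreal (c powr s) * (ennreal (norm x powr s) * indicator S (c *\<^sub>R x)) \<partial>lborel)"
    using assms by (subst nn_integral_scaleR_lborel[where c = c])
      (auto simp: powr_mult ennreal_mult mult.assoc)
  also have "\<dots> = ennreal (c ^ DIM('a)) * (ennreal (c powr s) *
        (\<integral>\<^sup>+x. ennreal (norm x powr s) * indicator S (c *\<^sub>R x) \<partial>lborel))"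
    by (subst nn_integral_cmult) auto
  also have "ennreal (c ^ DIM('a)) * (ennreal (c powr s) * I) =
      ennreal (c powr (s + DIM('a))) * I" for I
    using assms by (simp add: powr_add powr_realpow ennreal_mult ac_simps)
  finally show ?thesis .
qed

text \<open>Radius \<open>0\<close> is included because the slices of \<open>Omega_B k a\<close>
  degenerate where another coordinate vanishes; both sides are then \<open>0\<close>, even if the
  integral on the right diverges.\<close>

lemma nn_integral_norm_powr_ball:
  fixes r :: real
  assumes "r \<ge> 0"
  shows "(\<integral>\<^sup>+x. ennreal (norm x powr s) * indicator (ball (0::'a) r) x \<partial>lborel) =
         ennreal (r powr (s + DIM('a))) *
           (\<integral>\<^sup>+x\<in>ball (0::'a::euclidean_space) 1. ennreal (norm x powr s) \<partial>lborel)"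
proof (cases "r = 0")
  case False
  with assms have "r > 0" by simp
  moreover have "indicator (ball 0 r) (r *\<^sub>R x) = (indicator (ball 0 1) x :: ennreal)" for x :: 'a
    using \<open>r > 0\<close> by (auto simp: indicator_def)
  ultimately show ?thesis
    by (subst nn_integral_norm_powr_scale[where c = r]) simp_all
qed simp

text \<open>Nonempty open sets have positive measure. The set \<open>U\<close> avoids the origin,
  where the integrand is \<open>0\<close> by the convention \<open>0 powr s = 0\<close>.\<close>

lemma nn_integral_norm_powr_pos:
  fixes S :: "'a::euclidean_space set"
  assumes "S \<in> sets borel" "open U" "U \<noteq> {}" "U \<subseteq> S - {0}"
  shows "0 < (\<integral>\<^sup>+x\<in>S. ennreal (norm x powr s) \<partial>lborel)"
proof -
  note [measurable] = assms(1)
  have "U \<notin> null_sets lborel"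
    using open_not_negligible[OF assms(2,3)] null_sets_completionI[of U lborel]
    by (auto simp: negligible_iff_null_sets)
  with assms(2) have "0 < emeasure lborel U"
    by (auto simp: null_sets_def zero_less_iff_neq_zero)
  also have "\<dots> \<le> emeasure lborel (S - {0})"
    using assms(4) by (intro emeasure_mono) auto
  also have "S - {0} = {x \<in> space lborel. ennreal (norm x powr s) * indicator S x \<noteq> 0}"
    by (auto simp: indicator_def)
  finally have "(\<integral>\<^sup>+x\<in>S. ennreal (norm x powr s) \<partial>lborel) \<noteq> 0"
    by (subst nn_integral_0_iff) auto
  then show ?thesis
    by (simp add: zero_less_iff_neq_zero)
qed

lemma nn_integral_norm_powr_ball_pos:
  "0 < (\<integral>\<^sup>+x\<in>ball (0::'a::euclidean_space) 1. ennreal (norm x powr s) \<partial>lborel)"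
proof (rule nn_integral_norm_powr_pos)
  obtain b :: 'a where "b \<in> Basis" using nonempty_Basis by blast
  then have "(1/2) *\<^sub>R b \<in> ball 0 1 - {0}" by (auto simp: nonzero_Basis)
  then show "ball 0 1 - {0} \<noteq> ({} :: 'a set)" by blast
qed auto

text \<open>Cut the ball into the annuli \<open>1/2 ^ (n+1) \<le> norm x < 1/2 ^ n\<close>: by scaling, their
  integrals form a geometric series.\<close>

lemma nn_integral_norm_powr_ball_finite_iff:
  "(\<integral>\<^sup>+x\<in>ball (0::'a::euclidean_space) 1. ennreal (norm x powr s) \<partial>lborel) < \<infinity>
     \<longleftrightarrow> - real DIM('a) < s"
proof -
  define A :: "nat \<Rightarrow> 'a set" where "A n = ball 0 ((1/2) ^ n) - ball 0 ((1/2) ^ Suc n)" for n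
  define J where "J n = (\<integral>\<^sup>+x. ennreal (norm x powr s) * indicator (A n) x \<partial>lborel)" for n
  define c where "c = (1/2::real) powr (s + DIM('a))"
  have [measurable]: "A n \<in> sets borel" for n by (auto simp: A_def)
  have disj: "disjoint_family A"
    unfolding disjoint_family_on_def
  proof (intro ballI impI)
    have "A m \<inter> A n = {}" if "m < n" for m n
    proof -
      have "(1/2::real) ^ n \<le> (1/2) ^ Suc m"
        using that by (intro power_decreasing) auto
      then show ?thesis by (auto simp: A_def)
    qed
    then show "A m \<inter> A n = {}" if "m \<noteq> n" for m n
      using that by (metis Int_commute linorder_neqE_nat)
  qed
  have Un: "(\<Union>n. A n) = ball 0 1 - {0}"
  proof safe
    fix x :: 'a assume x: "x \<in> ball 0 1" "x \<notin> (\<Union>n. A n)"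
    \<comment> \<open>A point of the \<open>n\<close>-th ball outside \<open>A n\<close> lies in the
      next ball, so a point outside all annuli has norm below every power of
      \<open>1/2\<close>.\<close>
    have "norm x < (1/2) ^ n" for n
      by (induction n) (use x in \<open>auto simp: A_def\<close>)
    moreover have "\<exists>n. (1/2) ^ n < norm x" if "x \<noteq> 0"
      using that by (intro real_arch_pow_inv) auto
    ultimately show "x = 0" by (metis less_asym)
  next
    fix x n assume "x \<in> A n"
    then have "norm x < (1/2) ^ n" by (simp add: A_def)
    also have "\<dots> \<le> 1" by (intro power_le_one) auto
    finally show "x \<in> ball 0 1" by simp
  qed (auto simp: A_def)
  have J: "J n = ennreal (c ^ n) * J 0" for n
  proof -
    have "indicator (A n) ((1/2) ^ n *\<^sub>R x) = (indicator (A 0) x :: ennreal)" for x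
      by (auto simp: A_def indicator_def)
    then have "J n = ennreal (((1/2) ^ n) powr (s + DIM('a))) * J 0"
      unfolding J_def by (subst nn_integral_norm_powr_scale[where c = "(1/2) ^ n"]) auto
    also have "((1/2::real) ^ n) powr (s + DIM('a)) = c ^ n"
      unfolding c_def by (simp add: powr_power powr_realpow[symmetric] powr_powr mult.commute)
    finally show ?thesis .
  qed
  \<comment> \<open>The origin lies in no annulus, but it contributes nothing because
    \<open>0 powr s = 0\<close>.\<close>
  have "(\<integral>\<^sup>+x\<in>ball (0::'a) 1. ennreal (norm x powr s) \<partial>lborel)
      = (\<integral>\<^sup>+x. (\<Sum>n. ennreal (norm x powr s) * indicator (A n) x) \<partial>lborel)"
    unfolding ennreal_suminf_cmult suminf_indicator[OF disj] Un
    by (intro nn_integral_cong) (auto simp: indicator_def)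
  also have "\<dots> = (\<Sum>n. J n)"
    unfolding J_def by (intro nn_integral_suminf) auto
  also have "\<dots> = (\<Sum>n. ennreal (c ^ n) * J 0)"
    by (intro suminf_cong J)
  finally have sum: "(\<integral>\<^sup>+x\<in>ball (0::'a) 1. ennreal (norm x powr s) \<partial>lborel)
      = (\<Sum>n. ennreal (c ^ n) * J 0)" .
  \<comment> \<open>Once \<open>J 0\<close> is known to be positive and finite, convergence of the
    series depends on the ratio \<open>c\<close> alone.\<close>
  have "0 < J 0"
    unfolding J_def
  proof (rule nn_integral_norm_powr_pos)
    obtain b :: 'a where "b \<in> Basis" using nonempty_Basis by blast
    then have "(3/4) *\<^sub>R b \<in> ball 0 1 - cball 0 (1/2)" by simp
    then show "ball 0 1 - cball 0 (1/2) \<noteq> ({} :: 'a set)" by blast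
  qed (auto simp: A_def)
  moreover have "J 0 < \<infinity>"
  proof -
    \<comment> \<open>On \<open>A 0\<close> the norm lies between \<open>1/2\<close> and
      \<open>1\<close>; the two summands bound the integrand for \<open>s \<ge> 0\<close> and
      \<open>s < 0\<close> respectively.\<close>
    define M where "M = 1 + (1/2::real) powr s"
    have bd: "norm x powr s \<le> M" if "x \<in> A 0" for x
    proof (cases "s \<ge> 0")
      case True
      then have "norm x powr s \<le> 1 powr s"
        using that by (intro powr_mono2) (auto simp: A_def)
      then show ?thesis by (simp add: M_def add_increasing2)
    next
      case False
      then have "norm x powr s \<le> (1/2) powr s"
        using that by (intro powr_mono2') (auto simp: A_def)
      then show ?thesis by (simp add: M_def)
    qed
    have "J 0 \<le> (\<integral>\<^sup>+x. ennreal M * indicator (A 0) x \<partial>lborel)"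
      unfolding J_def using bd by (intro nn_integral_mono) (auto simp: indicator_def intro!: ennreal_leI)
    also have "\<dots> = ennreal M * emeasure lborel (A 0)"
      by (rule nn_integral_cmult_indicator) auto
    also have "\<dots> < \<infinity>"
    proof -
      have "emeasure lborel (A 0) < \<infinity>"
        by (rule emeasure_bounded_finite) (auto simp: A_def intro: bounded_subset[OF bounded_ball])
      then show ?thesis by (simp add: ennreal_mult_less_top)
    qed
    finally show ?thesis .
  qed
  ultimately obtain a where a: "J 0 = ennreal a" "a > 0"
    by (cases "J 0") auto
  have c: "c > 0" by (simp add: c_def)
  have "(\<Sum>n. ennreal (c ^ n) * J 0) = (\<Sum>n. ennreal (c ^ n * a))"
    using a c by (simp add: ennreal_mult)
  moreover have "(\<Sum>n. ennreal (c ^ n * a)) < \<infinity> \<longleftrightarrow> summable (\<lambda>n. c ^ n * a)"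
  proof
    assume "(\<Sum>n. ennreal (c ^ n * a)) < \<infinity>"
    then show "summable (\<lambda>n. c ^ n * a)"
      using a c by (intro summable_suminf_not_top) auto
  next
    assume "summable (\<lambda>n. c ^ n * a)"
    then show "(\<Sum>n. ennreal (c ^ n * a)) < \<infinity>"
      using a c by (subst suminf_ennreal2) auto
  qed
  moreover have "summable (\<lambda>n. c ^ n * a) \<longleftrightarrow> c < 1"
    using a c by (simp add: mult.commute[of _ a])
  moreover have "c < 1 \<longleftrightarrow> - real DIM('a) < s"
  proof -
    have "c < 1 \<longleftrightarrow> 0 < s + DIM('a)"
      unfolding c_def powr_def by (simp add: ln_div zero_less_mult_iff)
    then show ?thesis by auto
  qed
  ultimately show ?thesis unfolding sum by simp
qed

text \<open>Taken in \<open>ennreal\<close>, so that divergent moments are \<open>top\<close> and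
  the factorisation below holds for all exponents.\<close>

definition disc_moment :: "real \<Rightarrow> ennreal" where
  "disc_moment s = (\<integral>\<^sup>+w\<in>ball (0::complex) 1. ennreal (cmod w powr s) \<partial>lborel)"

lemma disc_moment_pos: "0 < disc_moment s"
  unfolding disc_moment_def by (rule nn_integral_norm_powr_ball_pos)

lemma disc_moment_finite_iff: "disc_moment s < \<infinity> \<longleftrightarrow> -2 < s"
  using nn_integral_norm_powr_ball_finite_iff[where 'a = complex, of s]
  by (simp add: disc_moment_def)

lemma nn_integral_cmod_powr_ball:
  "r \<ge> 0 \<Longrightarrow> (\<integral>\<^sup>+w\<in>ball (0::complex) r. ennreal (cmod w powr s) \<partial>lborel) =
    ennreal (r powr (s + 2)) * disc_moment s"
  unfolding disc_moment_def by (subst nn_integral_norm_powr_ball) simp_all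

section \<open>Integrals of monomials over the domain\<close>

lemma open_Omega_B: "open (Omega_B k (a :: 'a::finite))"
proof -
  have "open (\<Inter>j\<in>UNIV - {a}. {z::complex ^ 'a. cmod (z $ j) < 1})"
    by (intro open_INT ballI open_Collect_less continuous_intros) auto
  moreover have "open {z::complex ^ 'a. cmod (z $ a) ^ k a < (\<Prod>j\<in>UNIV - {a}. cmod (z $ j) ^ k j)}"
    by (intro open_Collect_less continuous_intros)
  ultimately show ?thesis
    by (rule back_subst[of "\<lambda>X. open X", OF open_Int]) (auto simp: Omega_B_def)
qed

text \<open>Taking the \<open>k a\<close>-th root exhibits the domain as a family of discs in the
  coordinate \<open>a\<close> whose radius is a monomial with real exponents.\<close>

lemma mem_Omega_B_iff:
  assumes "\<And>i. k i > 0"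
  shows "z \<in> Omega_B k a \<longleftrightarrow>
    cmod (z $ a) < (\<Prod>j\<in>UNIV - {a}. cmod (z $ j) powr (real (k j) / real (k a))) \<and>
    (\<forall>j\<in>UNIV - {a}. cmod (z $ j) < 1)"
proof -
  define r where "r = (\<Prod>j\<in>UNIV - {a}. cmod (z $ j) powr (real (k j) / real (k a)))"
  have "r ^ k a = (\<Prod>j\<in>UNIV - {a}. cmod (z $ j) ^ k j)"
    unfolding r_def prod_power_distrib
  proof (rule prod.cong)
    fix j
    have "(cmod (z $ j) powr (real (k j) / real (k a))) ^ k a = cmod (z $ j) powr (real (k j))"
      using assms[of a] assms[of j]
      by (cases "z $ j = 0") (simp_all add: powr_realpow[symmetric] powr_powr)
    \<comment> \<open>At \<open>z $ j = 0\<close> both sides vanish because \<open>k j > 0\<close>;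
      with exponent \<open>0\<close> they would differ, as \<open>0 powr 0 = 0\<close>.\<close>
    also have "\<dots> = cmod (z $ j) ^ k j"
      using assms[of j] by (cases "z $ j = 0") (auto simp: powr_realpow)
    finally show "(cmod (z $ j) powr (real (k j) / real (k a))) ^ k a = cmod (z $ j) ^ k j" .
  qed simp
  moreover have "r \<ge> 0" by (auto simp: r_def intro: prod_nonneg)
  ultimately have "cmod (z $ a) ^ k a < (\<Prod>j\<in>UNIV - {a}. cmod (z $ j) ^ k j) \<longleftrightarrow> cmod (z $ a) < r"
    using assms[of a] power_mono_iff[of r "cmod (z $ a)" "k a"] by (metis linorder_not_le norm_ge_zero)
  then show ?thesis by (auto simp: Omega_B_def r_def)
qed

text \<open>A slice of radius \<open>r\<close> contributes the factor
  \<open>r powr (s a + 2)\<close>. Since \<open>r\<close> is the product of the other moduli to the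
  powers \<open>k j / k a\<close>, this shifts each \<open>s j\<close> by
  \<open>k j / k a * (s a + 2)\<close>.\<close>

lemma nn_integral_Omega_B:
  fixes k :: "'n::finite \<Rightarrow> nat" and s :: "'n \<Rightarrow> real"
  assumes k: "\<And>i. k i > 0"
  shows "(\<integral>\<^sup>+z\<in>Omega_B k a. ennreal (\<Prod>i\<in>UNIV. cmod (z $ i) powr s i) \<partial>lborel) =
    disc_moment (s a) *
      (\<Prod>j\<in>UNIV - {a}. disc_moment (s j + real (k j) / real (k a) * (s a + 2)))"
proof -
  interpret product_sigma_finite "\<lambda>_::'n. lborel :: complex measure" ..
  define I where "I = UNIV - {a}"
  define P where "P = PiM I (\<lambda>_::'n. lborel :: complex measure)"
  define t where "t j = s j + real (k j) / real (k a) * (s a + 2)" for j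
  define f where "f z = ennreal (\<Prod>i\<in>UNIV. cmod (z $ i) powr s i) * indicator (Omega_B k a) z" for z
  have I: "finite I" "a \<notin> I" "insert a I = UNIV" by (auto simp: I_def)
  have Om [measurable]: "Omega_B k a \<in> sets borel" by (intro borel_open open_Omega_B)
  have f [measurable]: "f \<in> borel_measurable borel"
  proof -
    have [measurable]: "(\<lambda>z::complex ^ 'n. cmod (z $ i)) \<in> borel_measurable borel" for i
      by (intro borel_measurable_continuous_onI continuous_intros)
    show ?thesis unfolding f_def by measurable
  qed
  define g where "g j w = ennreal (cmod w powr t j) * indicator (ball 0 1) w" for j and w :: complex
  have [measurable]: "g j \<in> borel_measurable borel" for j
    unfolding g_def by (intro borel_measurable_times_ennreal borel_measurable_indicator) auto
  \<comment> \<open>The value of \<open>x\<close> at \<open>a\<close> is overwritten by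
    \<open>y\<close>, so \<open>x\<close> only fixes the remaining coordinates.\<close>
  have slice: "(\<integral>\<^sup>+y. f (\<chi> i. (x(a := y)) i) \<partial>lborel) = disc_moment (s a) * (\<Prod>j\<in>I. g j (x j))" for x
  proof -
    define r where "r = (\<Prod>j\<in>I. cmod (x j) powr (real (k j) / real (k a)))"
    define C where "C = (\<Prod>j\<in>I. ennreal (cmod (x j) powr s j) * indicator (ball 0 1) (x j))"
    have r: "r \<ge> 0" by (auto simp: r_def intro: prod_nonneg)
    have ind: "indicator (Omega_B k a) (\<chi> i. (x(a := y)) i)
        = (indicator (ball 0 r) y * (\<Prod>j\<in>I. indicator (ball 0 1) (x j)) :: ennreal)" for y
    proof -
      have "(\<Prod>j\<in>I. indicator (ball 0 1) (x j)) = (indicator {x. \<forall>j\<in>I. cmod (x j) < 1} x :: ennreal)"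
      proof (cases "\<forall>j\<in>I. cmod (x j) < 1")
        case False
        then show ?thesis using I(1) by (auto simp: indicator_def intro!: prod_zero)
      qed (simp add: indicator_def)
      moreover have "(\<chi> i. (x(a := y)) i) \<in> Omega_B k a \<longleftrightarrow> cmod y < r \<and> (\<forall>j\<in>I. cmod (x j) < 1)"
      proof -
        have "(\<Prod>j\<in>I. cmod ((x(a := y)) j) powr (real (k j) / real (k a))) = r"
          unfolding r_def using I(2) by (intro prod.cong) auto
        then show ?thesis
          unfolding mem_Omega_B_iff[OF k] I_def[symmetric] vec_lambda_beta using I(2) by auto
      qed
      ultimately show ?thesis by (auto simp: indicator_def)
    qed
    have "(\<Prod>i\<in>UNIV. cmod ((\<chi> i. (x(a := y)) i) $ i) powr s i)
        = cmod y powr s a * (\<Prod>j\<in>I. cmod (x j) powr s j)" for y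
    proof -
      have "(\<Prod>i\<in>I. cmod (if i = a then y else x i) powr s i) = (\<Prod>j\<in>I. cmod (x j) powr s j)"
        using I(2) by (intro prod.cong) auto
      then show ?thesis
        unfolding I(3)[symmetric] using I(1,2) by simp
    qed
    then have "f (\<chi> i. (x(a := y)) i) = C * (ennreal (cmod y powr s a) * indicator (ball 0 r) y)" for y
      unfolding f_def ind C_def
      by (simp add: ennreal_mult prod_nonneg prod_ennreal[symmetric] prod.distrib ac_simps)
    then have "(\<integral>\<^sup>+y. f (\<chi> i. (x(a := y)) i) \<partial>lborel)
        = (\<integral>\<^sup>+y. C * (ennreal (cmod y powr s a) * indicator (ball 0 r) y) \<partial>lborel)"
      by (simp only:)
    also have "\<dots> = C * (\<integral>\<^sup>+y. ennreal (cmod y powr s a) * indicator (ball 0 r) y \<partial>lborel)"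
      by (intro nn_integral_cmult borel_measurable_times_ennreal borel_measurable_indicator) auto
    also have "\<dots> = C * ennreal (r powr (s a + 2)) * disc_moment (s a)"
      using nn_integral_cmod_powr_ball[OF r] by (simp add: mult.assoc)
    also have "C * ennreal (r powr (s a + 2)) = (\<Prod>j\<in>I. g j (x j))"
    proof -
      have r_eq: "ennreal (r powr (s a + 2))
          = (\<Prod>j\<in>I. ennreal (cmod (x j) powr (real (k j) / real (k a) * (s a + 2))))"
        unfolding r_def by (simp add: prod_powr_distrib powr_powr prod_ennreal)
      show ?thesis
        unfolding C_def g_def t_def r_eq prod.distrib[symmetric]
        by (intro prod.cong) (auto simp: powr_add ennreal_mult ac_simps)
    qed
    finally show ?thesis by (simp add: mult.commute)
  qed
  have "(\<integral>\<^sup>+z. f z \<partial>lborel) = (\<integral>\<^sup>+x. f (\<chi> i. x i) \<partial>PiM (insert a I) (\<lambda>_. lborel))"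
    using nn_integral_lborel_vec[OF f] I(3) by simp
  also have "\<dots> = (\<integral>\<^sup>+x. (\<integral>\<^sup>+y. f (\<chi> i. (x(a := y)) i) \<partial>lborel) \<partial>P)"
    unfolding P_def
    by (rule product_nn_integral_insert[OF I(1,2)]) (unfold I(3), measurable)
  also have "\<dots> = disc_moment (s a) * (\<integral>\<^sup>+x. (\<Prod>j\<in>I. g j (x j)) \<partial>P)"
    unfolding slice P_def by (intro nn_integral_cmult) measurable
  also have "(\<integral>\<^sup>+x. (\<Prod>j\<in>I. g j (x j)) \<partial>P) = (\<Prod>j\<in>I. disc_moment (t j))"
    unfolding P_def disc_moment_def by (subst product_nn_integral_prod)
      (simp_all add: I(1), simp add: g_def[abs_def])
  finally show ?thesis unfolding f_def t_def I_def .
qed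

text \<open>As \<open>0 * top = 0\<close> in \<open>ennreal\<close>, a vanishing factor could hide a
  divergent one. All moments are positive, so the product is finite only if every factor is.\<close>

lemma nn_integral_Omega_B_finite_iff:
  fixes k :: "'n::finite \<Rightarrow> nat" and s :: "'n \<Rightarrow> real"
  assumes k: "\<And>i. k i > 0"
  shows "(\<integral>\<^sup>+z\<in>Omega_B k a. ennreal (\<Prod>i\<in>UNIV. cmod (z $ i) powr s i) \<partial>lborel) < \<infinity> \<longleftrightarrow>
    -2 < s a \<and> (\<forall>j. j \<noteq> a \<longrightarrow> -2 * (real (k a) + real (k j)) < real (k j) * s a + real (k a) * s j)"
proof -
  have "-2 < s j + real (k j) / real (k a) * (s a + 2) \<longleftrightarrow>
      -2 * (real (k a) + real (k j)) < real (k j) * s a + real (k a) * s j" for j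
    using k[of a] by (simp add: field_simps)
  then have fin: "disc_moment (s j + real (k j) / real (k a) * (s a + 2)) \<noteq> top \<longleftrightarrow>
      -2 * (real (k a) + real (k j)) < real (k j) * s a + real (k a) * s j" for j
    using disc_moment_finite_iff by (simp add: less_top[symmetric])
  have nz: "disc_moment t \<noteq> 0" for t
    using disc_moment_pos[of t] by simp
  have "disc_moment (s a) \<noteq> top \<longleftrightarrow> -2 < s a"
    using disc_moment_finite_iff by (simp add: less_top[symmetric])
  then show ?thesis
    unfolding nn_integral_Omega_B[OF k] infinity_ennreal_def less_top[symmetric]
    using fin nz by (auto simp: ennreal_mult_eq_top_iff ennreal_prod_eq_top)
qed

section \<open>Allowable indices\<close>

text \<open>The set \<open>z $ i = 0\<close> lies in the real hyperplane where the real part of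
  \<open>z $ i\<close> is \<open>0\<close>, which is a null set.\<close>

lemma AE_vec_nth_nonzero: "AE z :: complex ^ 'n::finite in lborel. \<forall>i. z $ i \<noteq> 0"
proof -
  have "AE z :: complex ^ 'n in lborel. z $ i \<noteq> 0" for i
  proof (rule AE_I')
    have ax: "axis i 1 \<in> (Basis :: (complex ^ 'n) set)"
      by (auto simp: Basis_vec_def Basis_complex_def)
    have "closed {z :: complex ^ 'n. z \<bullet> axis i 1 = 0}"
      by (intro closed_Collect_eq continuous_intros)
    then show "{z :: complex ^ 'n. z \<bullet> axis i 1 = 0} \<in> null_sets lborel"
      using negligible_standard_hyperplane[OF ax, of 0]
      by (simp add: negligible_iff_null_sets null_sets_completion_iff)
  qed (auto simp: inner_axis)
  then have "AE z :: complex ^ 'n in lborel. \<forall>i\<in>UNIV. z $ i \<noteq> 0"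
    by (intro AE_finite_allI) auto
  then show ?thesis by simp
qed

lemma nn_integral_laurent_domain:
  "(\<integral>\<^sup>+z\<in>laurent_domain \<alpha> \<Omega>. f z \<partial>lborel) = (\<integral>\<^sup>+z\<in>\<Omega>. f z \<partial>lborel)"
  using AE_vec_nth_nonzero
  by (intro nn_integral_cong_AE) (auto simp: laurent_domain_def indicator_def)

text \<open>The integrands agree only almost everywhere: for \<open>z $ i = 0\<close> and
  \<open>\<alpha> $ i = 0\<close> the factor with \<open>powi\<close> is \<open>1\<close>, whereas
  \<open>0 powr 0 = 0\<close>.\<close>

lemma nn_integral_laurent_monomial_powr:
  "(\<integral>\<^sup>+z\<in>\<Omega>. ennreal (cmod (laurent_monomial \<alpha> z) powr p) \<partial>lborel) =
   (\<integral>\<^sup>+z\<in>\<Omega>. ennreal (\<Prod>i\<in>UNIV. cmod (z $ i) powr (real_of_int (\<alpha> $ i) * p)) \<partial>lborel)"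
proof (rule nn_integral_cong_AE, rule AE_mp[OF AE_vec_nth_nonzero], intro AE_I2 impI)
  fix z :: "complex ^ 'a" assume "\<forall>i. z $ i \<noteq> 0"
  then have "cmod (z $ i) powi (\<alpha> $ i) = cmod (z $ i) powr real_of_int (\<alpha> $ i)" for i
    by (simp add: powr_real_of_int')
  then have "cmod (laurent_monomial \<alpha> z) powr p
      = (\<Prod>i\<in>UNIV. cmod (z $ i) powr (real_of_int (\<alpha> $ i) * p))"
    by (simp add: laurent_monomial_def prod_norm[symmetric] norm_power_int prod_powr_distrib powr_powr)
  then show "ennreal (cmod (laurent_monomial \<alpha> z) powr p) * indicator \<Omega> z =
      ennreal (\<Prod>i\<in>UNIV. cmod (z $ i) powr (real_of_int (\<alpha> $ i) * p)) * indicator \<Omega> z"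
    by simp
qed

lemma borel_measurable_laurent_monomial: "laurent_monomial \<alpha> \<in> borel_measurable borel"
proof -
  have [measurable]: "(\<lambda>z::complex ^ 'a. z $ i) \<in> borel_measurable borel" for i
    by (intro borel_measurable_continuous_onI continuous_intros)
  have "(\<lambda>z::complex ^ 'a. (z $ i) powi n) \<in> borel_measurable borel" for i n
    by (cases "n \<ge> 0") (simp_all add: power_int_def)
  then show ?thesis
    unfolding laurent_monomial_def[abs_def] by (intro borel_measurable_prod) auto
qed

text \<open>Each factor has a complex linear derivative of the form
  \<open>\<lambda>v. d * v $ i\<close>, and the product rule preserves complex linearity; hence the
  induction over finite sets of coordinates.\<close>

lemma holomorphic_sv_on_laurent_monomial:
  "holomorphic_sv_on (laurent_monomial \<alpha>) (laurent_domain \<alpha> \<Omega>)"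
  unfolding holomorphic_sv_on_def
proof
  fix z assume "z \<in> laurent_domain \<alpha> \<Omega>"
  then have z: "z $ i \<noteq> 0" if "\<alpha> $ i < 0" for i
    using that by (auto simp: laurent_domain_def)
  have fac: "\<exists>d. ((\<lambda>z. (z $ i) powi (\<alpha> $ i)) has_derivative (\<lambda>v. d * v $ i)) (at z)" for i
  proof -
    have "\<exists>d. ((\<lambda>w. w powi (\<alpha> $ i)) has_field_derivative d) (at (z $ i))"
    proof (cases "\<alpha> $ i < 0")
      case True
      with z show ?thesis by (intro exI) (rule derivative_eq_intros refl | simp)+
    next
      case False
      then have "(\<lambda>w::complex. w powi (\<alpha> $ i)) = (\<lambda>w. w ^ nat (\<alpha> $ i))"
        by (auto simp: power_int_def)
      then show ?thesis by (simp only:) (rule exI, rule DERIV_power, rule DERIV_ident)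
    qed
    then obtain d where "((\<lambda>w. w powi (\<alpha> $ i)) has_derivative (*) d) (at (z $ i))"
      unfolding has_field_derivative_def by blast
    moreover have "((\<lambda>z. z $ i) has_derivative (\<lambda>v. v $ i)) (at z)"
      by (rule bounded_linear_imp_has_derivative[OF bounded_linear_vec_nth])
    ultimately show ?thesis
      using has_derivative_compose[of "\<lambda>z. z $ i"] by blast
  qed
  have "\<exists>D. ((\<lambda>z. \<Prod>i\<in>S. (z $ i) powi (\<alpha> $ i)) has_derivative D) (at z) \<and>
      (\<forall>c v. D (c *s v) = c * D v)" if "finite S" for S
    using that
  proof induction
    case empty
    show ?case by (intro exI[of _ "\<lambda>_. 0"]) simp
  next
    case (insert i S)
    obtain D where D: "((\<lambda>z. \<Prod>i\<in>S. (z $ i) powi (\<alpha> $ i)) has_derivative D) (at z)"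
      "\<And>c v. D (c *s v) = c * D v"
      using insert.IH by blast
    obtain d where d: "((\<lambda>z. (z $ i) powi (\<alpha> $ i)) has_derivative (\<lambda>v. d * v $ i)) (at z)"
      using fac by blast
    show ?case
      using has_derivative_mult[OF d D(1)] D(2) insert.hyps
      by (intro exI conjI) (auto simp: algebra_simps)
  qed
  from this[of UNIV]
  show "\<exists>D. (laurent_monomial \<alpha> has_derivative D) (at z) \<and> (\<forall>c v. D (c *s v) = c * D v)"
    by (simp add: laurent_monomial_def[abs_def])
qed

text \<open>The pointwise bound \<open>cmod w \<le> 1 + cmod w powr p\<close>, integrated over a
  compact set, takes the place of Hoelder's inequality.\<close>

lemma locally_integrable_onI_powr:
  assumes p: "1 \<le> p" and [measurable]: "f \<in> borel_measurable borel"
    and fin: "(\<integral>\<^sup>+z\<in>\<Omega>. ennreal (cmod (f z) powr p) \<partial>lborel) < \<infinity>"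
  shows "locally_integrable_on f \<Omega>"
  unfolding locally_integrable_on_def set_integrable_def
proof (intro allI impI integrableI_bounded)
  fix K assume K: "compact K \<and> K \<subseteq> \<Omega>"
  then have [measurable]: "K \<in> sets borel" by (auto intro: borel_closed compact_imp_closed)
  show "(\<lambda>z. indicator K z *\<^sub>R f z) \<in> borel_measurable lborel" by measurable
  have "cmod w \<le> 1 + cmod w powr p" for w
    using powr_mono[OF p, of "cmod w"] by (cases "cmod w \<le> 1") (auto simp: add_increasing2)
  from ennreal_leI[OF this] have "ennreal (cmod w) \<le> 1 + ennreal (cmod w powr p)" for w
    by simp
  then have "(\<integral>\<^sup>+z. ennreal (cmod (indicator K z *\<^sub>R f z)) \<partial>lborel)
      \<le> (\<integral>\<^sup>+z. indicator K z + ennreal (cmod (f z) powr p) * indicator K z \<partial>lborel)"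
    by (intro nn_integral_mono) (simp add: indicator_def)
  also have "\<dots> = emeasure lborel K + (\<integral>\<^sup>+z\<in>K. ennreal (cmod (f z) powr p) \<partial>lborel)"
    by (subst nn_integral_add) auto
  also have "\<dots> < \<infinity>"
  proof -
    have "(\<integral>\<^sup>+z\<in>K. ennreal (cmod (f z) powr p) \<partial>lborel)
        \<le> (\<integral>\<^sup>+z\<in>\<Omega>. ennreal (cmod (f z) powr p) \<partial>lborel)"
      using K by (intro nn_integral_mono) (auto simp: indicator_def)
    then show ?thesis
      using emeasure_compact_finite[of K] K fin by (auto intro: le_less_trans)
  qed
  finally show "(\<integral>\<^sup>+z. ennreal (cmod (indicator K z *\<^sub>R f z)) \<partial>lborel) < \<infinity>" .
qed

text \<open>Holomorphy holds on the Laurent domain, local integrability follows from finiteness of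
  the integral, and the removed polar set is null; only the integral condition is left.\<close>

lemma allowable_indices_iff:
  assumes "1 \<le> p"
  shows "\<alpha> \<in> allowable_indices p \<Omega> \<longleftrightarrow>
    (\<integral>\<^sup>+z\<in>\<Omega>. ennreal (\<Prod>i\<in>UNIV. cmod (z $ i) powr (real_of_int (\<alpha> $ i) * p)) \<partial>lborel) < \<infinity>"
  using locally_integrable_onI_powr[OF assms borel_measurable_laurent_monomial]
  by (auto simp: allowable_indices_def bergman_space_def holomorphic_sv_on_laurent_monomial
      nn_integral_laurent_domain nn_integral_laurent_monomial_powr)

lemma allowable_indices_Omega_B_iff:
  assumes "1 \<le> p" "\<And>i. k i > 0"
  shows "\<alpha> \<in> allowable_indices p (Omega_B k a) \<longleftrightarrow>
    real_of_int (\<alpha> $ a) * p > -2 \<and>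
    (\<forall>j. j \<noteq> a \<longrightarrow>
      (real (k j) * real_of_int (\<alpha> $ a) + real (k a) * real_of_int (\<alpha> $ j)) * p
        > -2 * (real (k a) + real (k j)))"
  unfolding allowable_indices_iff[OF assms(1)] nn_integral_Omega_B_finite_iff[OF assms(2)]
  by (simp add: algebra_simps)

section \<open>Threshold exponents\<close>

lemma R_index_eq_of_int:
  "R_index k a j = of_int (2 * (int (k a div gcd (k a) (k j)) + int (k j div gcd (k a) (k j))))"
  by (simp add: R_index_def real_of_nat_div add_divide_distrib distrib_left)

lemma R_index_ge_2:
  assumes "k a > 0" "k j > 0"
  shows "R_index k a j \<ge> 2"
proof -
  have "1 \<le> k a div gcd (k a) (k j)"
    using assms by (simp add: Suc_le_eq div_greater_zero_iff gcd_le1_nat)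
  moreover have "2 \<le> 2 * (int u + int v)" if "1 \<le> u" for u v :: nat
    using that by (cases u) auto
  ultimately have "2 \<le> 2 * (int (k a div gcd (k a) (k j)) + int (k j div gcd (k a) (k j)))"
    by blast
  then show ?thesis
    unfolding R_index_eq_of_int using of_int_le_iff[where 'a = real] by (metis of_int_numeral)
qed

text \<open>Let \<open>f\<close> be the largest integer with \<open>f * p < N\<close>. As long as
  \<open>f * q < N \<le> (f + 1) * q\<close>, the condition on \<open>m\<close> at \<open>q\<close>
  reads \<open>m \<le> f\<close>, just as at \<open>p\<close>; so one neighbourhood serves all
  \<open>m\<close>. The excluded values are the quotients \<open>N / l\<close> above
  \<open>1\<close>.\<close>

lemma eventually_int_mult_less_iff:
  fixes p :: real and N :: int
  assumes p: "1 \<le> p" and ne: "\<And>l::int. 1 \<le> l \<Longrightarrow> l \<le> N - 1 \<Longrightarrow> p \<noteq> of_int N / of_int l"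
    and N: "1 \<le> N"
  shows "\<forall>\<^sub>F q in at p within {1..}. \<forall>m::int. of_int m * q < of_int N \<longleftrightarrow> of_int m * p < of_int N"
proof -
  obtain f :: int where f: "0 \<le> f" "of_int f * p < of_int N" "of_int N \<le> of_int (f + 1) * p"
    "\<forall>\<^sub>F q in at p within {1..}. of_int N \<le> of_int (f + 1) * q"
  proof (cases "p = 1")
    case True
    \<comment> \<open>Here \<open>(f + 1) * p = N\<close> holds with equality, which is not an open
      condition; it persists as an inequality because only \<open>q \<ge> 1\<close> is
      considered.\<close>
    have "\<forall>\<^sub>F q in at p within {1..}. real_of_int N \<le> of_int (N - 1 + 1) * q"
      unfolding eventually_at_filter using N by (auto simp: mult_le_cancel_left1)
    then show ?thesis
      using that[of "N - 1"] True N by auto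
  next
    case False
    with p have p: "p > 1" by simp
    define f where "f = \<lfloor>of_int N / p\<rfloor>"
    have "of_int f \<le> of_int N / p" "of_int N / p < of_int f + 1"
      using floor_correct[of "of_int N / p"] by (simp_all add: f_def)
    then have f: "of_int f * p \<le> of_int N" "of_int N < of_int (f + 1) * p"
      using p by (simp_all add: field_simps)
    have f0: "f \<ge> 0" using p N by (simp add: f_def)
    \<comment> \<open>Equality would give \<open>p = N / f\<close>, and \<open>p > 1\<close> puts
      \<open>f\<close> between \<open>1\<close> and \<open>N - 1\<close>, so this value is
      excluded.\<close>
    have "of_int f * p \<noteq> of_int N"
    proof
      assume eq: "of_int f * p = of_int N"
      with N f0 have "1 \<le> f" by (cases "f = 0") auto
      moreover have "real_of_int f < of_int N"
        using \<open>1 \<le> f\<close> p eq[symmetric] by simp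
      ultimately show False
        using ne[of f] eq by (auto simp: field_simps)
    qed
    with f have "of_int f * p < of_int N" by simp
    moreover have "((\<lambda>q. of_int (f + 1) * q) \<longlongrightarrow> of_int (f + 1) * p) (at p within {1..})"
      by (intro tendsto_intros)
    then have "\<forall>\<^sub>F q in at p within {1..}. of_int N < of_int (f + 1) * q"
      using f(2) by (rule order_tendstoD)
    then have "\<forall>\<^sub>F q in at p within {1..}. of_int N \<le> of_int (f + 1) * q"
      by eventually_elim simp
    ultimately show ?thesis using that f0 f(2) by (meson less_imp_le)
  qed
  have "((\<lambda>q. of_int f * q) \<longlongrightarrow> of_int f * p) (at p within {1..})"
    by (intro tendsto_intros)
  then have "\<forall>\<^sub>F q in at p within {1..}. of_int f * q < of_int N"
    using f(2) by (rule order_tendstoD)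
  moreover have "\<forall>\<^sub>F q in at p within {1..}. 1 \<le> q"
    by (simp add: eventually_at_filter)
  moreover note f(4)
  ultimately show ?thesis
  proof eventually_elim
    case (elim q)
    have key: "of_int m * r < of_int N \<longleftrightarrow> m \<le> f"
      if r: "1 \<le> r" "of_int f * r < of_int N" "of_int N \<le> of_int (f + 1) * r" for m and r :: real
    proof (cases "m \<le> f")
      case True
      then have "of_int m * r \<le> of_int f * r" using r by (intro mult_right_mono) auto
      from le_less_trans[OF this r(2)] show ?thesis using True by blast
    next
      case False
      then have "of_int (f + 1) * r \<le> of_int m * r" using r by (intro mult_right_mono) auto
      from order_trans[OF r(3) this] show ?thesis using False by linarith
    qed
    show ?case using key[OF p f(2,3)] key[OF elim(2) elim(1) elim(3)] by simp
  qed
qed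

text \<open>After division by \<open>gcd (k a) (k j)\<close> the \<open>j\<close>-th condition reads \<open>m * p < R_index k a j\<close> with an
  integer \<open>m\<close> depending on the index, and by Bezout every integer \<open>m\<close> occurs. The first condition
  only contributes \<open>p = 2\<close>, which is \<open>R_index k a j / l\<close> for \<open>l\<close> half of the even number
  \<open>R_index k a j\<close>. At \<open>p = 1\<close> the jump on the left is invisible, as only \<open>q \<ge> 1\<close> are considered.\<close>

lemma threshold_exponents_Omega_B:
  fixes k :: "'n::finite \<Rightarrow> nat"
  assumes card: "CARD('n) \<ge> 2" and k: "\<And>i. k i > 0"
  shows "threshold_exponents (Omega_B k a) =
    {R_index k a j / real_of_int l | j l. j \<noteq> a \<and> 1 \<le> l \<and> real_of_int l \<le> R_index k a j - 1}"
    (is "_ = ?T")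
proof
  define R where "R j = 2 * (int (k a div gcd (k a) (k j)) + int (k j div gcd (k a) (k j)))" for j
  have R: "R_index k a j = of_int (R j)" for j
    unfolding R_def by (rule R_index_eq_of_int)
  have R2: "2 \<le> R j" for j
    using R_index_ge_2[of k a j] k by (simp add: R)
  define g where "g j = gcd (k a) (k j)" for j
  have g: "g j > 0" for j using k[of a] by (simp add: g_def)
  have gR: "real (g j) * of_int (R j) = 2 * (real (k a) + real (k j))" for j
    using g[of j] by (simp add: R[symmetric] R_index_def g_def)
  \<comment> \<open>The sign turns the lower bounds on the index into upper bounds, and division by
    \<open>g j\<close> leaves coprime coefficients.\<close>
  define m where "m \<alpha> j = - (int (k j div g j) * \<alpha> $ a + int (k a div g j) * \<alpha> $ j)" for \<alpha> :: "int ^ 'n" and j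
  have m: "real (k j) * real_of_int (\<alpha> $ a) + real (k a) * real_of_int (\<alpha> $ j) = - real (g j) * of_int (m \<alpha> j)"
    for \<alpha> :: "int ^ 'n" and j
  proof -
    have "real (k j) = real (g j) * real (k j div g j)" "real (k a) = real (g j) * real (k a div g j)"
      unfolding g_def of_nat_mult[symmetric] by simp_all
    then show ?thesis by (simp add: m_def algebra_simps)
  qed
  have cond: "-2 * (real (k a) + real (k j)) < (real (k j) * real_of_int (\<alpha> $ a) + real (k a) * real_of_int (\<alpha> $ j)) * q
      \<longleftrightarrow> of_int (m \<alpha> j) * q < of_int (R j)" for \<alpha> :: "int ^ 'n" and j q
  proof -
    have "-2 * (real (k a) + real (k j)) = - real (g j) * of_int (R j)"
      using gR[of j] by simp
    then show ?thesis
      unfolding m using g[of j] by (simp add: mult.assoc)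
  qed
  have mem: "\<alpha> \<in> allowable_indices q (Omega_B k a) \<longleftrightarrow>
      of_int (- \<alpha> $ a) * q < of_int 2 \<and> (\<forall>j\<in>UNIV - {a}. of_int (m \<alpha> j) * q < of_int (R j))"
    if "1 \<le> q" for \<alpha> q
    unfolding allowable_indices_Omega_B_iff[OF that k] cond by auto

  show "threshold_exponents (Omega_B k a) \<subseteq> ?T"
  proof
    fix p assume p: "p \<in> threshold_exponents (Omega_B k a)"
    then have p1: "1 \<le> p" by (simp add: threshold_exponents_def)
    show "p \<in> ?T"
    proof (rule ccontr)
      assume "p \<notin> ?T"
      then have ne: "p \<noteq> of_int (R j) / of_int l" if "j \<noteq> a" "1 \<le> l" "l \<le> R j - 1" for j and l :: int
        using that by (fastforce simp: R)
      \<comment> \<open>Dimension at least two enters here: the exponent \<open>2\<close> has to be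
        covered by some coordinate other than \<open>a\<close>.\<close>
      obtain j where j: "j \<noteq> a"
        using card by (metis UNIV_I card_2_iff' card_le_Suc0_iff_eq finite not_less_eq_eq numeral_2_eq_2)
      have half: "p \<noteq> 2"
      proof -
        have "R j = 2 * (R j div 2)" by (simp add: R_def)
        with R2[of j] have "1 \<le> R j div 2" "R j div 2 \<le> R j - 1" "of_int (R j) / of_int (R j div 2) = (2::real)"
          by (auto simp: field_simps)
        then show ?thesis using ne[OF j, of "R j div 2"] by auto
      qed
      \<comment> \<open>With all integers \<open>m\<close> quantified inside, the neighbourhood is
        uniform in the infinitely many indices, and only finitely many coordinates have to be
        intersected.\<close>
      have "\<forall>\<^sub>F q in at p within {1..}. \<forall>m::int. of_int m * q < of_int 2 \<longleftrightarrow> of_int m * p < of_int 2"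
      proof (rule eventually_int_mult_less_iff[OF p1])
        fix l :: int assume "1 \<le> l" "l \<le> 2 - 1"
        then have "l = 1" by simp
        then show "p \<noteq> of_int 2 / of_int l" using half by simp
      qed simp
      moreover have "\<forall>\<^sub>F q in at p within {1..}. \<forall>j\<in>UNIV - {a}. \<forall>m::int.
          of_int m * q < of_int (R j) \<longleftrightarrow> of_int m * p < of_int (R j)"
      proof (intro eventually_ball_finite ballI)
        fix i assume "i \<in> UNIV - {a}"
        then show "\<forall>\<^sub>F q in at p within {1..}. \<forall>m::int.
            of_int m * q < of_int (R i) \<longleftrightarrow> of_int m * p < of_int (R i)"
          using ne R2[of i] by (intro eventually_int_mult_less_iff[OF p1]) auto
      qed simp
      moreover have "\<forall>\<^sub>F q in at p within {1..}. 1 \<le> q"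
        by (simp add: eventually_at_filter)
      ultimately have "\<forall>\<^sub>F q in at p within {1..}.
          allowable_indices q (Omega_B k a) = allowable_indices p (Omega_B k a)"
      proof eventually_elim
        case (elim q)
        show ?case
          unfolding set_eq_iff mem[OF elim(3)] mem[OF p1] using elim(1,2) by blast
      qed
      then obtain e where e: "e > 0" "\<And>q. 1 \<le> q \<Longrightarrow> q \<noteq> p \<Longrightarrow> dist q p < e \<Longrightarrow>
          allowable_indices q (Omega_B k a) = allowable_indices p (Omega_B k a)"
        unfolding eventually_at by auto
      obtain q where q: "q \<in> {p - e<..<p + e}" "1 \<le> q"
          "allowable_indices q (Omega_B k a) \<noteq> allowable_indices p (Omega_B k a)"
        using p \<open>e > 0\<close> unfolding threshold_exponents_def by blast
      then have "dist q p < e" by (auto simp: dist_real_def)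
      with e(2)[of q] q show False by auto
    qed
  qed

  show "?T \<subseteq> threshold_exponents (Omega_B k a)"
  proof
    fix p assume "p \<in> ?T"
    then obtain j l where j: "j \<noteq> a" and l: "1 \<le> l" "l \<le> R j - 1" and p: "p = of_int (R j) / of_int l"
      by (fastforce simp: R)
    have p1: "1 < p" using l by (simp add: p)
    obtain u v where uv_g: "u * int (k j) + v * int (k a) = int (g j)"
      using bezout_int[of "int (k j)" "int (k a)"] by (metis g_def gcd.commute gcd_int_int_eq)
    have uv: "- (l * u) * int (k j) + - (l * v) * int (k a) = - l * int (g j)"
      unfolding uv_g[symmetric] by (simp add: algebra_simps)
    \<comment> \<open>Adding \<open>t\<close> times \<open>(int (k a), - int (k j))\<close> to the
      Bezout solution keeps \<open>m \<alpha> j = l\<close> and makes \<open>x\<close> nonnegative.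
      All conditions other than the \<open>j\<close>-th then hold for every
      \<open>q \<ge> 1\<close>.\<close>
    define t where "t = \<bar>l * u\<bar>"
    define x where "x = - (l * u) + t * int (k a)"
    define y where "y = - (l * v) - t * int (k j)"
    define \<alpha> where "\<alpha> = (\<chi> i. if i = a then x else if i = j then y else 0)"
    have "t * 1 \<le> t * int (k a)" using k[of a] by (intro mult_left_mono) (auto simp: t_def)
    then have x: "0 \<le> x" by (simp add: x_def t_def)
    have "x * int (k j) + y * int (k a) = - l * int (g j)"
      using uv by (simp add: x_def y_def algebra_simps)
    then have "real_of_int (x * int (k j) + y * int (k a)) = of_int (- l * int (g j))"
      by (simp only:)
    then have "real (g j) * of_int (m \<alpha> j) = real (g j) * of_int l"
      using m[of j \<alpha>] j by (auto simp: \<alpha>_def mult.commute)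
    then have mj: "m \<alpha> j = l" using g[of j] by simp
    have mi: "m \<alpha> i \<le> 0" if "i \<noteq> a" "i \<noteq> j" for i
      using that x by (simp add: m_def \<alpha>_def)
    have \<alpha>: "\<alpha> \<in> allowable_indices q (Omega_B k a) \<longleftrightarrow> of_int l * q < of_int (R j)" if q: "1 \<le> q" for q
    proof -
      have "of_int (m \<alpha> i) * q < of_int (R i)" if "i \<noteq> a" "i \<noteq> j" for i
      proof -
        have "of_int (m \<alpha> i) * q \<le> 0"
          using mi[OF that] q by (intro mult_nonpos_nonneg) auto
        also have "0 < real_of_int (R i)" using R2[of i] by simp
        finally show ?thesis .
      qed
      moreover have "of_int (- \<alpha> $ a) * q < of_int 2"
      proof -
        have "of_int (- \<alpha> $ a) * q \<le> 0"
          using x q by (intro mult_nonpos_nonneg) (auto simp: \<alpha>_def)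
        then show ?thesis by simp
      qed
      ultimately show ?thesis unfolding mem[OF q] using mj j by auto
    qed
    show "p \<in> threshold_exponents (Omega_B k a)"
      unfolding threshold_exponents_def
    proof (intro CollectI conjI allI impI)
      show "1 \<le> p" using p1 by simp
      fix \<epsilon> :: real assume "\<epsilon> > 0"
      \<comment> \<open>The strict inequality \<open>l * q < R j\<close> holds to the left of
        \<open>p\<close> and fails at \<open>p\<close>. Since \<open>l \<le> R j - 1\<close> forces
        \<open>p > 1\<close>, there is room for such a \<open>q\<close> in the admissible
        range.\<close>
      define q where "q = max 1 (p - \<epsilon> / 2)"
      have q: "1 \<le> q" "q < p" "q \<in> {p - \<epsilon><..<p + \<epsilon>}"
        using \<open>\<epsilon> > 0\<close> p1 by (auto simp: q_def)
      have "of_int l * p = of_int (R j)" using l by (simp add: p)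
      moreover have "of_int l * q < of_int l * p" using q l by simp
      ultimately have "\<alpha> \<in> allowable_indices q (Omega_B k a)" "\<alpha> \<notin> allowable_indices p (Omega_B k a)"
        using \<alpha>[OF q(1)] \<alpha>[of p] p1 by simp_all
      with q show "\<exists>q\<in>{p - \<epsilon><..<p + \<epsilon>}. 1 \<le> q \<and>
          allowable_indices q (Omega_B k a) \<noteq> allowable_indices p (Omega_B k a)"
        by blast
    qed
  qed
qed

theorem proposition4p5:
  fixes k :: "'n::finite \<Rightarrow> nat" and a :: 'n
  assumes "CARD('n) \<ge> 2"
    and "\<And>i. k i > 0"
    and "Gcd (range k) = 1"
  shows "(\<forall>p::real. 1 \<le> p \<longrightarrow>
            allowable_indices p (Omega_B k a) =
              {\<alpha> :: int ^ 'n.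
                 real_of_int (\<alpha> $ a) * p > -2 \<and>
                 (\<forall>j. j \<noteq> a \<longrightarrow>
                    (real (k j) * real_of_int (\<alpha> $ a) + real (k a) * real_of_int (\<alpha> $ j)) * p
                      > -2 * (real (k a) + real (k j)))}) \<and>
         threshold_exponents (Omega_B k a) =
           {R_index k a j / real_of_int l | j l.
              j \<noteq> a \<and> 1 \<le> l \<and> real_of_int l \<le> R_index k a j - 1}"
proof (intro conjI allI impI)
  fix p :: real assume "1 \<le> p"
  from allowable_indices_Omega_B_iff[of p k, OF this assms(2)]
  show "allowable_indices p (Omega_B k a) =
              {\<alpha> :: int ^ 'n.
                 real_of_int (\<alpha> $ a) * p > -2 \<and>
                 (\<forall>j. j \<noteq> a \<longrightarrow>
                    (real (k j) * real_of_int (\<alpha> $ a) + real (k a) * real_of_int (\<alpha> $ j)) * p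
                      > -2 * (real (k a) + real (k j)))}"
    by blast
qed (rule threshold_exponents_Omega_B[OF assms(1), of k, OF assms(2)])

end
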